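(* Let $K$ be a field of arbitrary characteristic, and let $X=\{x_1,\ldots,x_n\}$, $n\ge 2$, and $Z=\{z_1,\ldots,z_m\}$ be disjoint finite sets of variables. Let \[ \varphi=(f_1(X,Z),\ldots,f_n(X,Z),z_1,\ldots,z_m) \] be an automorphism of the absolutely free algebra $K\{X,Z\}$ fixing the variables $Z$. Then $\varphi$ is tame in the class of $Z$-automorphisms.
   Context: $K\{X,Z\}$ is the absolutely free algebra on the set $X\cup Z$: the algebra (with constants from $K$, i.e. unital) of all polynomials in noncommuting and nonassociative variables $X\cup Z$. An automorphism is written as the tuple of the images of $x_1,\ldots,x_n,z_1,\ldots,z_m$. A $Z$-automorphism is an automorphism fixing every $z_1,\ldots,z_m$. It is $Z$-elementary if it is of the form $(x_1,\ldots,x_{j-1},\alpha x_j+f(X,Z),x_{j+1},\ldots,x_n,z_1,\ldots,z_m)$ with $\alpha\in K^{\ast}$ and $f(X,Z)$ not depending on $x_j$. A $Z$-automorphism is tame in the class of $Z$-automorphisms ($Z$-tame) if it belongs to the group generated by the $Z$-elementary automorphisms. *)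

theory Defs
  imports
    "HOL-Library.Poly_Mapping"
    "HOL-Algebra.Bij"
    "HOL-Algebra.Generated_Groups"
begin

text \<open>
  Nonempty nonassociative words over an alphabet, i.e. the free magma. The basis of the unital
  absolutely free algebra consists of these words together with the empty word, which is
  represented by \<^const>\<open>None\<close>.
\<close>

datatype (word_vars: 'v) nword = Letter 'v | Node "'v nword" "'v nword"

type_synonym 'v nmon = "'v nword option"

fun mon_mult :: "'v nmon \<Rightarrow> 'v nmon \<Rightarrow> 'v nmon" where
  "mon_mult None t = t"
| "mon_mult s None = s"
| "mon_mult (Some u) (Some v) = Some (Node u v)"

text \<open>
  The algebra on the set of all elements of the type \<^typ>\<open>'v\<close>. Addition, zero and
  subtraction are those of finitely supported functions; the product cannot be the library's
  convolution product, which requires an associative operation on the exponents.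
\<close>

type_synonym ('v, 'k) free_alg = "'v nmon \<Rightarrow>\<^sub>0 'k"

definition fa_const :: "'k \<Rightarrow> ('v, 'k::field) free_alg" where
  "fa_const c = Poly_Mapping.single None c"

definition fa_var :: "'v \<Rightarrow> ('v, 'k::field) free_alg" where
  "fa_var x = Poly_Mapping.single (Some (Letter x)) 1"

definition fa_scale :: "'k \<Rightarrow> ('v, 'k::field) free_alg \<Rightarrow> ('v, 'k) free_alg" where
  "fa_scale c p = Poly_Mapping.map (\<lambda>a. c * a) p"

definition fa_mult :: "('v, 'k::field) free_alg \<Rightarrow> ('v, 'k) free_alg \<Rightarrow> ('v, 'k) free_alg" where
  "fa_mult p q = (\<Sum>s\<in>Poly_Mapping.keys p. \<Sum>t\<in>Poly_Mapping.keys q.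
     Poly_Mapping.single (mon_mult s t) (Poly_Mapping.lookup p s * Poly_Mapping.lookup q t))"

definition fa_vars :: "('v, 'k::field) free_alg \<Rightarrow> 'v set" where
  "fa_vars p = {x. \<exists>w. Some w \<in> Poly_Mapping.keys p \<and> x \<in> word_vars w}"

lemma lookup_fa_scale: "Poly_Mapping.lookup (fa_scale c p) s = c * Poly_Mapping.lookup p s"
  by (simp add: fa_scale_def map.rep_eq when_def)

lemma fa_mult_superset:
  assumes "finite A" "finite B" "Poly_Mapping.keys p \<subseteq> A" "Poly_Mapping.keys q \<subseteq> B"
  shows "fa_mult p q = (\<Sum>s\<in>A. \<Sum>t\<in>B.
     Poly_Mapping.single (mon_mult s t) (Poly_Mapping.lookup p s * Poly_Mapping.lookup q t))"
proof -
  have "(\<Sum>s\<in>A. \<Sum>t\<in>B. Poly_Mapping.single (mon_mult s t) (Poly_Mapping.lookup p s * Poly_Mapping.lookup q t))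
      = (\<Sum>s\<in>A. \<Sum>t\<in>Poly_Mapping.keys q. Poly_Mapping.single (mon_mult s t) (Poly_Mapping.lookup p s * Poly_Mapping.lookup q t))"
    using assms by (intro sum.cong[OF refl] sum.mono_neutral_right) (auto simp: in_keys_iff)
  also have "\<dots> = fa_mult p q"
    unfolding fa_mult_def
    using assms by (intro sum.mono_neutral_right) (auto simp: in_keys_iff)
  finally show ?thesis ..
qed

lemma fa_mult_single:
  "fa_mult (Poly_Mapping.single s a) (Poly_Mapping.single t b)
     = Poly_Mapping.single (mon_mult s t) (a * b)"
  by (subst fa_mult_superset[of "{s}" "{t}"]) auto

lemma fa_mult_add_left: "fa_mult (p + q) r = fa_mult p r + fa_mult q r"
  using keys_add[of p q]
  by (simp add: fa_mult_superset[of "Poly_Mapping.keys p \<union> Poly_Mapping.keys q" "Poly_Mapping.keys r"] lookup_add distrib_right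
      single_add sum.distrib)

lemma fa_mult_add_right: "fa_mult r (p + q) = fa_mult r p + fa_mult r q"
  using keys_add[of p q]
  by (simp add: fa_mult_superset[of "Poly_Mapping.keys r" "Poly_Mapping.keys p \<union> Poly_Mapping.keys q"] lookup_add distrib_left
      single_add sum.distrib)

lemma fa_mult_const_left: "fa_mult (fa_const c) p = fa_scale c p"
proof (rule poly_mapping_eqI)
  fix u
  have "fa_mult (fa_const c) p = (\<Sum>t\<in>Poly_Mapping.keys p. Poly_Mapping.single t (c * Poly_Mapping.lookup p t))"
    by (subst fa_mult_superset[of "{None}" "Poly_Mapping.keys p"]) (auto simp: fa_const_def)
  then show "Poly_Mapping.lookup (fa_mult (fa_const c) p) u = Poly_Mapping.lookup (fa_scale c p) u"
    by (auto simp: lookup_sum lookup_single lookup_fa_scale when_def in_keys_iff)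
qed

lemma fa_mult_const_right: "fa_mult p (fa_const c) = fa_scale c p"
proof (rule poly_mapping_eqI)
  fix u
  have [simp]: "mon_mult t None = t" for t :: "'a nmon"
    by (cases t) auto
  have "fa_mult p (fa_const c) = (\<Sum>t\<in>Poly_Mapping.keys p. Poly_Mapping.single t (Poly_Mapping.lookup p t * c))"
    by (subst fa_mult_superset[of "Poly_Mapping.keys p" "{None}"]) (auto simp: fa_const_def)
  then show "Poly_Mapping.lookup (fa_mult p (fa_const c)) u = Poly_Mapping.lookup (fa_scale c p) u"
    by (auto simp: lookup_sum lookup_single lookup_fa_scale when_def in_keys_iff)
qed

definition fa_hom :: "(('v, 'k::field) free_alg \<Rightarrow> ('v, 'k) free_alg) \<Rightarrow> bool" where
  "fa_hom \<phi> \<longleftrightarrow>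
     (\<forall>p q. \<phi> (p + q) = \<phi> p + \<phi> q) \<and>
     (\<forall>c p. \<phi> (fa_scale c p) = fa_scale c (\<phi> p)) \<and>
     (\<forall>p q. \<phi> (fa_mult p q) = fa_mult (\<phi> p) (\<phi> q)) \<and>
     \<phi> (fa_const 1) = fa_const 1"

definition fa_automorphism :: "(('v, 'k::field) free_alg \<Rightarrow> ('v, 'k) free_alg) \<Rightarrow> bool" where
  "fa_automorphism \<phi> \<longleftrightarrow> fa_hom \<phi> \<and> bij \<phi>"

definition Z_automorphism ::
  "'v set \<Rightarrow> (('v, 'k::field) free_alg \<Rightarrow> ('v, 'k) free_alg) \<Rightarrow> bool" where
  "Z_automorphism Z \<phi> \<longleftrightarrow> fa_automorphism \<phi> \<and> (\<forall>z\<in>Z. \<phi> (fa_var z) = fa_var z)"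

text \<open>
  The tuple of images of the variables determines an endomorphism, so the form of an elementary
  automorphism is expressed through these images.
\<close>

definition Z_elementary ::
  "'v set \<Rightarrow> 'v set \<Rightarrow> (('v, 'k::field) free_alg \<Rightarrow> ('v, 'k) free_alg) \<Rightarrow> bool" where
  "Z_elementary X Z \<phi> \<longleftrightarrow> Z_automorphism Z \<phi> \<and>
     (\<exists>x\<in>X. \<exists>\<alpha> f. \<alpha> \<noteq> 0 \<and> x \<notin> fa_vars f \<and>
        \<phi> (fa_var x) = fa_scale \<alpha> (fa_var x) + f \<and>
        (\<forall>y\<in>X - {x}. \<phi> (fa_var y) = fa_var y))"

text \<open>
  The generated subgroup is taken in the group of all bijections of the algebra, whose operation
  is composition; its inverses are the inverse maps.
\<close>

definition Z_tame ::
  "'v set \<Rightarrow> 'v set \<Rightarrow> (('v, 'k::field) free_alg \<Rightarrow> ('v, 'k) free_alg) \<Rightarrow> bool" where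
  "Z_tame X Z \<phi> \<longleftrightarrow> \<phi> \<in> generate (BijGroup UNIV) {\<psi>. Z_elementary X Z \<psi>}"

end

theory Submission
  imports Defs
begin

text \<open>
  The proof is a Nielsen-type reduction. Give the variable \<open>x\<close> the weight
  \<open>\<omega> x\<close>, the degree of \<open>\<phi> x\<close>. Then \<open>\<phi>\<close> sends an element of weight \<open>d\<close>
  to one of degree at most \<open>d\<close>, and the question is whether some combination of words of
  weight exactly \<open>d\<close> drops in degree; call such a combination a leading relation.

  In a nonassociative word \<open>Node u v\<close> the two factors can be read off, so the product of
  constant-free elements is a tensor product. Hence a leading relation that involves no letter splits
  into leading relations among the left factors and among the right factors, both of smaller weight:
  by induction, if no leading relation has a letter with nonzero coefficient, then all are
  trivial (\<open>leading_relation_trivial\<close>). This replaces the general theorem that reduced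
  systems freely generate a subalgebra.

  If some leading relation does involve a letter \<open>x\<close> of \<open>X\<close>, then it has the form
  \<open>\<alpha> x + f\<close> where, for reasons of weight, \<open>x\<close> does not occur in \<open>f\<close>. Composing
  \<open>\<phi>\<close> with the elementary automorphism that sends \<open>x\<close> to \<open>\<alpha> x + f\<close> lowers the degree of
  the image of \<open>x\<close> and changes no other image (\<open>leading_relation_reduces_degree\<close>), so
  induction on the sum of the degrees applies.

  Otherwise a letter with nonzero coefficient in a leading relation belongs to \<open>Z\<close> and is fixed
  by \<open>\<phi>\<close>. Such a relation would have weight 1 and be a linear relation between distinct
  variables, which is impossible (\<open>leading_relation_fixed_letter\<close>). With all leading relations trivial,
  \<open>\<phi>\<close> carries positive weight to the same degree, so every element with affine image is affine
  (\<open>affine_preimage\<close>). What remains is Gaussian elimination for affine substitutions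
  (\<open>Z_tame_affine\<close>). Constant terms play along: in top degree they contribute nothing to a
  product, and an elementary step may contain a constant.
\<close>

section \<open>The algebra and its endomorphisms\<close>

abbreviation coeff :: "('v, 'k::field) free_alg \<Rightarrow> 'v nmon \<Rightarrow> 'k" where
  "coeff \<equiv> Poly_Mapping.lookup"

abbreviation monomial :: "'v nmon \<Rightarrow> ('v, 'k::field) free_alg" where
  "monomial s \<equiv> Poly_Mapping.single s 1"

lemma fa_scale_single: "fa_scale c (Poly_Mapping.single s a) = Poly_Mapping.single s (c * a)"
  by (rule poly_mapping_eqI) (auto simp: lookup_fa_scale lookup_single when_def)

lemma fa_scale_zero [simp]: "fa_scale c 0 = 0" "fa_scale 0 p = 0"
  by (auto intro!: poly_mapping_eqI simp: lookup_fa_scale)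

lemma fa_scale_one [simp]: "fa_scale 1 p = p"
  by (auto intro!: poly_mapping_eqI simp: lookup_fa_scale)

lemma fa_scale_scale [simp]: "fa_scale a (fa_scale b p) = fa_scale (a * b) p"
  by (auto intro!: poly_mapping_eqI simp: lookup_fa_scale)

lemma fa_scale_add: "fa_scale c (p + q) = fa_scale c p + fa_scale c q"
  by (auto intro!: poly_mapping_eqI simp: lookup_fa_scale lookup_add distrib_left)

lemma fa_scale_add_left: "fa_scale (a + b) p = fa_scale a p + fa_scale b p"
  by (auto intro!: poly_mapping_eqI simp: lookup_fa_scale lookup_add distrib_right)

lemma fa_scale_sum: "fa_scale c (sum f A) = (\<Sum>a\<in>A. fa_scale c (f a))"
  by (induction A rule: infinite_finite_induct) (auto simp: fa_scale_add)

lemma fa_mult_zero [simp]: "fa_mult 0 q = 0" "fa_mult p 0 = 0"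
  by (simp_all add: fa_mult_def)

lemma fa_mult_sum_left: "fa_mult (sum f A) q = (\<Sum>a\<in>A. fa_mult (f a) q)"
  by (induction A rule: infinite_finite_induct) (auto simp: fa_mult_add_left)

lemma fa_mult_sum_right: "fa_mult q (sum f A) = (\<Sum>a\<in>A. fa_mult q (f a))"
  by (induction A rule: infinite_finite_induct) (auto simp: fa_mult_add_right)

lemma keys_fa_scale: "Poly_Mapping.keys (fa_scale c p) \<subseteq> Poly_Mapping.keys p"
  by (auto simp: in_keys_iff lookup_fa_scale)

lemma fa_mult_scale:
  "fa_mult (fa_scale a p) (fa_scale b q) = fa_scale (a * b) (fa_mult p q)"
proof -
  have "fa_mult (fa_scale a p) (fa_scale b q) =
      (\<Sum>s\<in>Poly_Mapping.keys p. \<Sum>t\<in>Poly_Mapping.keys q.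
         Poly_Mapping.single (mon_mult s t) (coeff (fa_scale a p) s * coeff (fa_scale b q) t))"
    by (rule fa_mult_superset) (auto simp: keys_fa_scale)
  also have "\<dots> = fa_scale (a * b) (fa_mult p q)"
    unfolding fa_mult_def
    by (simp add: fa_scale_sum fa_scale_single lookup_fa_scale mult_ac)
  finally show ?thesis .
qed

lemma fa_sum_monomials: "(\<Sum>s\<in>Poly_Mapping.keys p. fa_scale (coeff p s) (monomial s)) = p"
  by (rule poly_mapping_eqI)
     (auto simp: lookup_sum fa_scale_single lookup_single when_def in_keys_iff)

fun eval_word :: "('v \<Rightarrow> ('v, 'k::field) free_alg) \<Rightarrow> 'v nword \<Rightarrow> ('v, 'k) free_alg" where
  "eval_word g (Letter x) = g x"
| "eval_word g (Node u v) = fa_mult (eval_word g u) (eval_word g v)"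

fun eval_mon :: "('v \<Rightarrow> ('v, 'k::field) free_alg) \<Rightarrow> 'v nmon \<Rightarrow> ('v, 'k) free_alg" where
  "eval_mon g None = fa_const 1"
| "eval_mon g (Some w) = eval_word g w"

definition fa_eval ::
  "('v \<Rightarrow> ('v, 'k::field) free_alg) \<Rightarrow> ('v, 'k) free_alg \<Rightarrow> ('v, 'k) free_alg" where
  "fa_eval g p = (\<Sum>s\<in>Poly_Mapping.keys p. fa_scale (coeff p s) (eval_mon g s))"

lemma fa_eval_superset:
  assumes "finite A" "Poly_Mapping.keys p \<subseteq> A"
  shows "fa_eval g p = (\<Sum>s\<in>A. fa_scale (coeff p s) (eval_mon g s))"
  unfolding fa_eval_def using assms
  by (intro sum.mono_neutral_left) (auto simp: in_keys_iff)

lemma fa_eval_add: "fa_eval g (p + q) = fa_eval g p + fa_eval g q"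
  using keys_add[of p q]
  by (simp add: fa_eval_superset[of "Poly_Mapping.keys p \<union> Poly_Mapping.keys q"]
      lookup_add fa_scale_add_left sum.distrib)

lemma fa_eval_scale: "fa_eval g (fa_scale c p) = fa_scale c (fa_eval g p)"
  using keys_fa_scale[of c p]
  by (simp add: fa_eval_superset[of "Poly_Mapping.keys p"] lookup_fa_scale fa_scale_sum)

lemma fa_eval_sum: "fa_eval g (sum f A) = (\<Sum>a\<in>A. fa_eval g (f a))"
  by (induction A rule: infinite_finite_induct) (auto simp: fa_eval_add, simp_all add: fa_eval_def)

lemma fa_eval_single: "fa_eval g (Poly_Mapping.single s a) = fa_scale a (eval_mon g s)"
  by (subst fa_eval_superset[of "{s}"]) auto

lemma eval_mon_mult: "eval_mon g (mon_mult s t) = fa_mult (eval_mon g s) (eval_mon g t)"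
  by (cases s; cases t) (auto simp: fa_mult_const_left fa_mult_const_right)

lemma fa_hom_eval: "fa_hom (fa_eval g)"
proof -
  have "fa_eval g (fa_mult p q) = fa_mult (fa_eval g p) (fa_eval g q)" for p q
  proof -
    have "fa_eval g (fa_mult p q) = (\<Sum>s\<in>Poly_Mapping.keys p. \<Sum>t\<in>Poly_Mapping.keys q.
        fa_mult (fa_scale (coeff p s) (eval_mon g s)) (fa_scale (coeff q t) (eval_mon g t)))"
      unfolding fa_mult_def[of p]
      by (simp add: fa_eval_sum fa_eval_single eval_mon_mult fa_mult_scale)
    also have "\<dots> = fa_mult (fa_eval g p) (fa_eval g q)"
      unfolding fa_eval_def[of g] fa_mult_sum_left fa_mult_sum_right by (rule refl sum.swap)
    finally show ?thesis .
  qed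
  then show ?thesis
    unfolding fa_hom_def fa_const_def
    by (auto simp: fa_eval_add fa_eval_scale fa_eval_single fa_const_def)
qed

lemma fa_eval_var: "fa_eval g (fa_var x) = g x"
  by (simp add: fa_var_def fa_eval_single)

lemma fa_hom_add: "fa_hom \<phi> \<Longrightarrow> \<phi> (p + q) = \<phi> p + \<phi> q"
  and fa_hom_scale: "fa_hom \<phi> \<Longrightarrow> \<phi> (fa_scale c p) = fa_scale c (\<phi> p)"
  and fa_hom_mult: "fa_hom \<phi> \<Longrightarrow> \<phi> (fa_mult p q) = fa_mult (\<phi> p) (\<phi> q)"
  and fa_hom_one: "fa_hom \<phi> \<Longrightarrow> \<phi> (monomial None) = monomial None"
  by (auto simp: fa_hom_def fa_const_def)

lemma fa_hom_zero: "fa_hom \<phi> \<Longrightarrow> \<phi> 0 = 0"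
  using fa_hom_scale[of \<phi> 0 0] by simp

lemma fa_hom_sum: "fa_hom \<phi> \<Longrightarrow> \<phi> (sum f A) = (\<Sum>a\<in>A. \<phi> (f a))"
  by (induction A rule: infinite_finite_induct) (auto simp: fa_hom_add fa_hom_zero)

text \<open>
  Linearity reduces every question about a homomorphism to its values on monomials.
\<close>

lemma fa_hom_expand:
  assumes "fa_hom \<phi>"
  shows "\<phi> p = (\<Sum>s\<in>Poly_Mapping.keys p. fa_scale (coeff p s) (\<phi> (monomial s)))"
proof -
  have "\<phi> (\<Sum>s\<in>Poly_Mapping.keys p. fa_scale (coeff p s) (monomial s)) =
      (\<Sum>s\<in>Poly_Mapping.keys p. fa_scale (coeff p s) (\<phi> (monomial s)))"
    by (simp add: fa_hom_sum[OF assms] fa_hom_scale[OF assms])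
  then show ?thesis by (simp add: fa_sum_monomials)
qed

lemma fa_hom_node:
  assumes "fa_hom \<phi>"
  shows "\<phi> (monomial (Some (Node u v))) = fa_mult (\<phi> (monomial (Some u))) (\<phi> (monomial (Some v)))"
  using fa_hom_mult[OF assms, of "monomial (Some u)" "monomial (Some v)"]
  by (simp add: fa_mult_single)

text \<open>
  Only the variables that occur in \<open>p\<close> matter. The local form gives both the uniqueness of
  an endomorphism with prescribed images of the variables and the fact that an element is fixed once
  its variables are.
\<close>

lemma fa_hom_eqI:
  assumes "fa_hom \<phi>" "fa_hom \<psi>" and eq: "\<And>x. x \<in> fa_vars p \<Longrightarrow> \<phi> (fa_var x) = \<psi> (fa_var x)"
  shows "\<phi> p = \<psi> p"
proof -
  have words: "\<phi> (monomial (Some w)) = \<psi> (monomial (Some w))" if "word_vars w \<subseteq> fa_vars p" for w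
    using that
    by (induction w) (use eq in \<open>auto simp: fa_var_def fa_hom_node[OF assms(1)] fa_hom_node[OF assms(2)]\<close>)
  have "\<phi> (monomial s) = \<psi> (monomial s)" if "s \<in> Poly_Mapping.keys p" for s
  proof (cases s)
    case None
    then show ?thesis by (simp add: fa_hom_one assms)
  next
    case (Some w)
    then show ?thesis using that words[of w] by (auto simp: fa_vars_def)
  qed
  then show ?thesis
    by (subst (1 2) fa_hom_expand) (simp_all add: assms)
qed

lemma fa_hom_id: "fa_hom (\<lambda>p. p)"
  by (simp add: fa_hom_def)

lemma fa_hom_comp: "fa_hom \<phi> \<Longrightarrow> fa_hom \<psi> \<Longrightarrow> fa_hom (\<phi> \<circ> \<psi>)"
  by (simp add: fa_hom_def)

lemma fa_hom_fixes:
  assumes "fa_hom \<phi>" "\<And>x. x \<in> fa_vars p \<Longrightarrow> \<phi> (fa_var x) = fa_var x"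
  shows "\<phi> p = p"
  using fa_hom_eqI[OF assms(1) fa_hom_id] assms(2) by blast

section \<open>Elementary automorphisms\<close>

definition elementary :: "'v \<Rightarrow> 'k \<Rightarrow> ('v, 'k::field) free_alg \<Rightarrow> ('v, 'k) free_alg \<Rightarrow> ('v, 'k) free_alg" where
  "elementary x \<alpha> f = fa_eval (fa_var(x := fa_scale \<alpha> (fa_var x) + f))"

lemma elementary_same: "elementary x \<alpha> f (fa_var x) = fa_scale \<alpha> (fa_var x) + f"
  and elementary_other: "y \<noteq> x \<Longrightarrow> elementary x \<alpha> f (fa_var y) = fa_var y"
  by (simp_all add: elementary_def fa_eval_var)

lemma fa_hom_elementary: "fa_hom (elementary x \<alpha> f)"
  by (simp add: elementary_def fa_hom_eval)

lemma elementary_fixes: "x \<notin> fa_vars p \<Longrightarrow> elementary x \<alpha> f p = p"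
  by (rule fa_hom_fixes[OF fa_hom_elementary]) (auto intro: elementary_other)

lemma fa_vars_scale: "fa_vars (fa_scale c p) \<subseteq> fa_vars p"
  using keys_fa_scale[of c p] by (auto simp: fa_vars_def)

text \<open>
  The substitution \<open>x \<mapsto> \<alpha> x + f\<close> fixes \<open>f\<close>, because \<open>x\<close> does not occur
  there; solving for \<open>x\<close> therefore gives the inverse, which is again elementary.
\<close>

lemma elementary_comp_inverse:
  assumes "\<alpha> \<noteq> 0" "x \<notin> fa_vars f"
  shows "elementary x \<alpha> f (elementary x (1 / \<alpha>) (fa_scale (- 1 / \<alpha>) f) p) = p"
proof -
  have "elementary x \<alpha> f (elementary x (1 / \<alpha>) (fa_scale (- 1 / \<alpha>) f) (fa_var y)) = fa_var y" for y
  proof (cases "y = x")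
    case True
    have "elementary x \<alpha> f (elementary x (1 / \<alpha>) (fa_scale (- 1 / \<alpha>) f) (fa_var x)) =
        fa_scale (1 / \<alpha>) (fa_scale \<alpha> (fa_var x) + f) + fa_scale (- 1 / \<alpha>) f"
      using assms(2)
      by (simp add: elementary_same elementary_fixes fa_hom_add[OF fa_hom_elementary]
          fa_hom_scale[OF fa_hom_elementary])
    also have "\<dots> = fa_var x"
      using assms(1)
      by (auto intro!: poly_mapping_eqI simp: lookup_fa_scale lookup_add field_simps)
    finally show ?thesis using True by simp
  qed (simp add: elementary_other)
  then show ?thesis
    using fa_hom_fixes[OF fa_hom_comp[OF fa_hom_elementary[of x \<alpha> f]
          fa_hom_elementary[of x "1 / \<alpha>" "fa_scale (- 1 / \<alpha>) f"]], of p]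
    by simp
qed

lemma elementary_inverse_comp:
  assumes "\<alpha> \<noteq> 0" "x \<notin> fa_vars f"
  shows "elementary x (1 / \<alpha>) (fa_scale (- 1 / \<alpha>) f) (elementary x \<alpha> f p) = p"
proof -
  have "x \<notin> fa_vars (fa_scale (- 1 / \<alpha>) f)" using fa_vars_scale assms(2) by fastforce
  then show ?thesis
    using elementary_comp_inverse[of "1 / \<alpha>" x "fa_scale (- 1 / \<alpha>) f" p] assms(1) by simp
qed

lemma bij_elementary:
  assumes "\<alpha> \<noteq> 0" "x \<notin> fa_vars f"
  shows "bij (elementary x \<alpha> f)"
  using elementary_inverse_comp[OF assms] elementary_comp_inverse[OF assms]
  by (intro o_bij[of "elementary x (1 / \<alpha>) (fa_scale (- 1 / \<alpha>) f)"]) auto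

lemma Z_elementary_elementary:
  assumes "\<alpha> \<noteq> 0" "x \<notin> fa_vars f" "x \<in> X" "x \<notin> Z"
  shows "Z_elementary X Z (elementary x \<alpha> f)"
proof -
  have "Z_automorphism Z (elementary x \<alpha> f)"
    using assms bij_elementary fa_hom_elementary elementary_other[of _ x]
    unfolding Z_automorphism_def fa_automorphism_def by metis
  then show ?thesis
    unfolding Z_elementary_def using assms elementary_same[of x \<alpha> f] elementary_other[of _ x \<alpha> f]
    by blast
qed

lemma Z_automorphism_comp:
  "Z_automorphism Z \<phi> \<Longrightarrow> Z_automorphism Z \<psi> \<Longrightarrow> Z_automorphism Z (\<phi> \<circ> \<psi>)"
  unfolding Z_automorphism_def fa_automorphism_def
  by (auto intro: fa_hom_comp bij_comp)

lemma Z_tame_id: "Z_tame X Z id"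
  using generate.one[of "BijGroup UNIV" "{\<psi>. Z_elementary X Z \<psi>}"]
  by (simp add: Z_tame_def BijGroup_def id_def restrict_UNIV)

lemma Z_tame_comp_elementary:
  assumes "Z_tame X Z \<phi>" "bij \<phi>" "Z_elementary X Z \<epsilon>"
  shows "Z_tame X Z (\<phi> \<circ> \<epsilon>)"
proof -
  have "bij \<epsilon>"
    using assms(3) by (simp add: Z_elementary_def Z_automorphism_def fa_automorphism_def)
  then have "\<phi> \<otimes>\<^bsub>BijGroup UNIV\<^esub> \<epsilon> = \<phi> \<circ> \<epsilon>"
    using assms(2) by (auto simp: BijGroup_def Bij_def compose_def)
  moreover have "\<phi> \<otimes>\<^bsub>BijGroup UNIV\<^esub> \<epsilon> \<in> generate (BijGroup UNIV) {\<psi>. Z_elementary X Z \<psi>}"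
    using assms(1,3) by (intro generate.eng) (auto simp: Z_tame_def intro: generate.incl)
  ultimately show ?thesis by (simp add: Z_tame_def)
qed

text \<open>
  Every reduction step below passes from \<open>\<phi>\<close> to \<open>\<phi> \<circ> \<epsilon>\<close>. Since the inverse of
  \<open>\<epsilon>\<close> is itself elementary, tameness is recovered by one more composition.
\<close>

lemma Z_tame_cancel_elementary:
  assumes "\<alpha> \<noteq> 0" "x \<notin> fa_vars f" "x \<in> X" "x \<notin> Z"
    and "Z_automorphism Z \<phi>"
    and "Z_automorphism Z (\<phi> \<circ> elementary x \<alpha> f) \<Longrightarrow> Z_tame X Z (\<phi> \<circ> elementary x \<alpha> f)"
  shows "Z_tame X Z \<phi>"
proof -
  let ?\<epsilon> = "elementary x \<alpha> f" and ?\<delta> = "elementary x (1 / \<alpha>) (fa_scale (- 1 / \<alpha>) f)"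
  have \<epsilon>: "Z_elementary X Z ?\<epsilon>" using assms by (intro Z_elementary_elementary)
  have "x \<notin> fa_vars (fa_scale (- 1 / \<alpha>) f)" using fa_vars_scale assms(2) by fastforce
  then have \<delta>: "Z_elementary X Z ?\<delta>"
    using assms by (intro Z_elementary_elementary) auto
  have aut: "Z_automorphism Z (\<phi> \<circ> ?\<epsilon>)"
    using \<epsilon> assms(5) by (auto simp: Z_elementary_def intro: Z_automorphism_comp)
  then have "bij (\<phi> \<circ> ?\<epsilon>)"
    unfolding Z_automorphism_def fa_automorphism_def by blast
  then have "Z_tame X Z ((\<phi> \<circ> ?\<epsilon>) \<circ> ?\<delta>)"
    using assms(6)[OF aut] \<delta> by (intro Z_tame_comp_elementary[of X Z "\<phi> \<circ> ?\<epsilon>"])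
  moreover have "(\<phi> \<circ> ?\<epsilon>) \<circ> ?\<delta> = \<phi>"
    using elementary_comp_inverse[OF assms(1,2)] by auto
  ultimately show ?thesis by simp
qed

section \<open>Weights and degrees\<close>

fun weight :: "('v \<Rightarrow> nat) \<Rightarrow> 'v nword \<Rightarrow> nat" where
  "weight \<omega> (Letter x) = \<omega> x"
| "weight \<omega> (Node u v) = weight \<omega> u + weight \<omega> v"

abbreviation word_length :: "'v nword \<Rightarrow> nat" where
  "word_length \<equiv> weight (\<lambda>_. 1)"

text \<open>
  The constant monomial has length 0, so constant terms never influence the degree, and the elements
  of degree 0 are exactly the constants, 0 included.
\<close>

fun mon_length :: "'v nmon \<Rightarrow> nat" where
  "mon_length None = 0"
| "mon_length (Some w) = word_length w"

definition fa_degree :: "('v, 'k::field) free_alg \<Rightarrow> nat" where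
  "fa_degree p = Max (insert 0 (mon_length ` Poly_Mapping.keys p))"

lemma fa_degree_le_iff: "fa_degree p \<le> n \<longleftrightarrow> (\<forall>s. coeff p s \<noteq> 0 \<longrightarrow> mon_length s \<le> n)"
  by (auto simp: fa_degree_def in_keys_iff)

lemma mon_length_le_degree: "coeff p s \<noteq> 0 \<Longrightarrow> mon_length s \<le> fa_degree p"
  using fa_degree_le_iff by blast

lemma weight_pos: "(\<And>x. \<omega> x \<ge> 1) \<Longrightarrow> weight \<omega> w \<ge> (1::nat)"
  by (induction w) (auto simp: trans_le_add1)

lemma fa_degree_zero:
  assumes "fa_degree p = 0"
  shows "p = fa_const (coeff p None)"
proof (rule poly_mapping_eqI)
  fix s
  have "coeff p (Some w) = 0" for w
    using mon_length_le_degree[of p "Some w"] weight_pos[of "\<lambda>_. 1" w] assms by auto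
  then show "coeff p s = coeff (fa_const (coeff p None)) s"
    by (cases s) (auto simp: fa_const_def lookup_single)
qed

text \<open>
  A proper product containing \<open>x\<close> outweighs \<open>x\<close>, as its other factors have positive
  weight. This is what makes a leading relation with a letter an elementary substitution.
\<close>

lemma weight_occurs:
  assumes "\<And>x. \<omega> x \<ge> (1::nat)" "x \<in> word_vars w"
  shows "w = Letter x \<or> \<omega> x < weight \<omega> w"
  using assms(2)
proof (induction w)
  case (Node u v)
  have "weight \<omega> u \<ge> 1" "weight \<omega> v \<ge> 1" by (intro weight_pos assms(1))+
  then show ?case using Node by force
qed auto

lemma mon_length_mult: "mon_length (mon_mult s t) = mon_length s + mon_length t"
  by (cases s; cases t) auto

lemma coeff_mult:
  "coeff (fa_mult p q) r = (\<Sum>s\<in>Poly_Mapping.keys p. \<Sum>t\<in>Poly_Mapping.keys q.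
     coeff p s * coeff q t when mon_mult s t = r)"
  by (simp add: fa_mult_def lookup_sum lookup_single)

lemma coeff_mult_nonzero:
  assumes "coeff (fa_mult p q) r \<noteq> 0"
  obtains s t where "coeff p s \<noteq> 0" "coeff q t \<noteq> 0" "r = mon_mult s t"
proof -
  obtain s where s: "s \<in> Poly_Mapping.keys p" "(\<Sum>t\<in>Poly_Mapping.keys q.
     coeff p s * coeff q t when mon_mult s t = r) \<noteq> 0"
    using assms unfolding coeff_mult by (rule sum.not_neutral_contains_not_neutral)
  from s(2) obtain t where "t \<in> Poly_Mapping.keys q" "(coeff p s * coeff q t when mon_mult s t = r) \<noteq> 0"
    by (rule sum.not_neutral_contains_not_neutral)
  then show ?thesis using that[of s t] by (auto simp: when_def split: if_splits)
qed

text \<open>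
  The word \<open>Node s t\<close> is a product of two nonempty words in just one way; besides that it has
  only the trivial factorizations with the empty word on one side. The first summand is the
  tensor product structure; the other two come from the constant terms.
\<close>

lemma coeff_mult_node:
  "coeff (fa_mult p q) (Some (Node s t)) = coeff p (Some s) * coeff q (Some t)
     + coeff p None * coeff q (Some (Node s t)) + coeff p (Some (Node s t)) * coeff q None"
proof -
  let ?n = "Some (Node s t)"
  define A where "A = Poly_Mapping.keys p \<union> {None, Some s, ?n}"
  define B where "B = Poly_Mapping.keys q \<union> {None, Some t, ?n}"
  define P where "P = {(Some s, Some t), (None, ?n), (?n, None)}"
  have split: "(a, b) \<in> P" if "mon_mult a b = ?n" for a b
    using that by (cases a; cases b) (auto simp: P_def)
  have "coeff (fa_mult p q) ?n = (\<Sum>a\<in>A. \<Sum>b\<in>B. coeff p a * coeff q b when mon_mult a b = ?n)"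
    by (subst fa_mult_superset[of A B]) (auto simp: A_def B_def lookup_sum lookup_single)
  also have "\<dots> = (\<Sum>(a, b)\<in>A \<times> B. coeff p a * coeff q b when mon_mult a b = ?n)"
    by (rule sum.cartesian_product)
  also have "\<dots> = (\<Sum>(a, b)\<in>P. coeff p a * coeff q b when mon_mult a b = ?n)"
  proof (rule sum.mono_neutral_right)
    show "finite (A \<times> B)" by (simp add: A_def B_def)
    show "P \<subseteq> A \<times> B" by (auto simp: A_def B_def P_def)
    show "\<forall>i\<in>A \<times> B - P. (case i of (a, b) \<Rightarrow> coeff p a * coeff q b when mon_mult a b = ?n) = 0"
      using split by (auto simp: when_def)
  qed
  also have "\<dots> = coeff p (Some s) * coeff q (Some t)
     + coeff p None * coeff q ?n + coeff p ?n * coeff q None"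
    by (simp add: P_def)
  finally show ?thesis .
qed

section \<open>Independence of leading parts\<close>

text \<open>
  The weight of a variable stands for the degree of its image; under the bound below, the image of a
  combination of words of weight at most \<open>d\<close> has degree at most \<open>d\<close>.
\<close>

locale weighted_hom =
  fixes \<phi> :: "('v, 'k::field) free_alg \<Rightarrow> ('v, 'k) free_alg" and \<omega> :: "'v \<Rightarrow> nat"
  assumes hom: "fa_hom \<phi>"
    and pos: "\<omega> x \<ge> 1"
    and degree_var: "fa_degree (\<phi> (fa_var x)) \<le> \<omega> x"
begin

text \<open>
  The matrix of \<open>\<phi>\<close> in the basis of nonempty words. The entries with
  \<open>t\<close> longer than the weight of \<open>w\<close> vanish; those with equality describe the leading part of
  the image of \<open>w\<close>.
\<close>

definition word_coeff :: "'v nword \<Rightarrow> 'v nword \<Rightarrow> 'k" where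
  "word_coeff w t = coeff (\<phi> (monomial (Some w))) (Some t)"

lemma weight_ge_1: "weight \<omega> w \<ge> 1"
  by (rule weight_pos[OF pos])

lemma degree_word: "fa_degree (\<phi> (monomial (Some w))) \<le> weight \<omega> w"
proof (induction w)
  case (Letter x)
  then show ?case using degree_var[of x] by (simp add: fa_var_def)
next
  case (Node u v)
  show ?case
    unfolding fa_degree_le_iff fa_hom_node[OF hom]
  proof (intro allI impI)
    fix r
    assume "coeff (fa_mult (\<phi> (monomial (Some u))) (\<phi> (monomial (Some v)))) r \<noteq> 0"
    then show "mon_length r \<le> weight \<omega> (Node u v)"
      by (rule coeff_mult_nonzero)
         (use Node in \<open>auto simp: fa_degree_le_iff mon_length_mult intro: add_mono\<close>)
  qed
qed

lemma word_coeff_zero: "weight \<omega> w < word_length t \<Longrightarrow> word_coeff w t = 0"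
  using degree_word[of w] by (force simp: fa_degree_le_iff word_coeff_def)

text \<open>
  In top degree the constant term of one factor contributes nothing: it is paired with the coefficient
  of the other factor at the whole word, which is longer than the weight of that factor. So the leading
  part of a product is the tensor product of the leading parts.
\<close>

lemma word_coeff_node:
  assumes "word_length s + word_length t = weight \<omega> u + weight \<omega> v"
  shows "word_coeff (Node u v) (Node s t) = word_coeff u s * word_coeff v t"
proof -
  have "word_coeff u (Node s t) = 0" "word_coeff v (Node s t) = 0"
    using assms weight_ge_1[of u] weight_ge_1[of v] by (auto intro!: word_coeff_zero)
  then show ?thesis
    by (simp add: word_coeff_def fa_hom_node[OF hom] coeff_mult_node)
qed

lemma coeff_hom_combination:
  "coeff (\<phi> (\<Sum>w\<in>A. fa_scale (c w) (monomial (Some w)))) (Some t) = (\<Sum>w\<in>A. c w * word_coeff w t)"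
  by (simp add: fa_hom_sum[OF hom] fa_hom_scale[OF hom] lookup_sum lookup_fa_scale word_coeff_def)

lemma degree_hom_combination:
  assumes "\<And>w. w \<in> A \<Longrightarrow> weight \<omega> w \<le> d"
  shows "fa_degree (\<phi> (\<Sum>w\<in>A. fa_scale (c w) (monomial (Some w)))) \<le> d"
  unfolding fa_degree_le_iff
proof (intro allI impI)
  fix s
  assume nz: "coeff (\<phi> (\<Sum>w\<in>A. fa_scale (c w) (monomial (Some w)))) s \<noteq> 0"
  show "mon_length s \<le> d"
  proof (cases s)
    case (Some t)
    with nz obtain w where "w \<in> A" "word_coeff w t \<noteq> 0"
      unfolding Some coeff_hom_combination
      by (auto elim!: sum.not_neutral_contains_not_neutral)
    then have "word_length t \<le> weight \<omega> w" using word_coeff_zero not_le by blast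
    then show ?thesis using assms[OF \<open>w \<in> A\<close>] Some by simp
  qed simp
qed

lemma coeff_hom:
  assumes "finite A" "\<And>w. coeff p (Some w) \<noteq> 0 \<Longrightarrow> w \<in> A"
  shows "coeff (\<phi> p) (Some t) = (\<Sum>w\<in>A. coeff p (Some w) * word_coeff w t)"
proof -
  let ?g = "\<lambda>s. coeff p s * coeff (\<phi> (monomial s)) (Some t)"
  have "coeff (\<phi> p) (Some t) = sum ?g (Poly_Mapping.keys p)"
    by (subst fa_hom_expand[OF hom]) (simp add: lookup_sum lookup_fa_scale)
  also have "\<dots> = sum ?g (insert None (Some ` A))"
  proof (rule sum.mono_neutral_left)
    show "Poly_Mapping.keys p \<subseteq> insert None (Some ` A)"
    proof
      fix s assume "s \<in> Poly_Mapping.keys p"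
      then show "s \<in> insert None (Some ` A)"
        using assms(2) by (cases s) (auto simp: in_keys_iff)
    qed
    show "\<forall>s\<in>insert None (Some ` A) - Poly_Mapping.keys p. ?g s = 0"
      by (simp add: in_keys_iff)
  qed (use assms(1) in simp)
  also have "\<dots> = sum ?g (Some ` A)"
    using assms(1) by (subst sum.insert) (auto simp: fa_hom_one[OF hom] lookup_single)
  also have "\<dots> = (\<Sum>w\<in>A. coeff p (Some w) * word_coeff w t)"
    by (subst sum.reindex) (auto simp: word_coeff_def)
  finally show ?thesis .
qed

text \<open>
  The combination of the words in \<open>A\<close> with coefficients \<open>c\<close> has weight \<open>d\<close>, but no
  word of length \<open>d\<close> is left in its image: a linear relation between the leading parts of the images.
\<close>

definition leading_relation :: "nat \<Rightarrow> 'v nword set \<Rightarrow> ('v nword \<Rightarrow> 'k) \<Rightarrow> bool" where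
  "leading_relation d A c \<longleftrightarrow> finite A \<and> (\<forall>w\<in>A. weight \<omega> w = d) \<and>
     (\<forall>t. word_length t = d \<longrightarrow> (\<Sum>w\<in>A. c w * word_coeff w t) = 0)"

text \<open>
  A leading relation without letters is a sum of products \<open>u v\<close>. Comparing coefficients at
  \<open>Node s t\<close> for a fixed right factor \<open>t\<close> gives a leading relation between the left
  factors, whose coefficients are, by induction, zero; these coefficients being zero for all
  \<open>t\<close> is a leading relation between the right factors, and induction applies a second time.
\<close>

lemma leading_relation_trivial:
  assumes letters: "\<And>d A c x. leading_relation d A c \<Longrightarrow> Letter x \<in> A \<Longrightarrow> c (Letter x) = 0"
  shows "leading_relation d A c \<Longrightarrow> w \<in> A \<Longrightarrow> c w = 0"
proof (induction d arbitrary: A c w rule: less_induct)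
  case (less d)
  have fin: "finite A" and wA: "\<And>w. w \<in> A \<Longrightarrow> weight \<omega> w = d"
    and rel: "\<And>t. word_length t = d \<Longrightarrow> (\<Sum>w\<in>A. c w * word_coeff w t) = 0"
    using less.prems(1) by (auto simp: leading_relation_def)
  show ?case
  proof (cases w)
    case (Letter x)
    then show ?thesis using letters less.prems by blast
  next
    case (Node u\<^sub>0 v\<^sub>0)
    \<comment> \<open>Index the relation by a full rectangle of factors, extending the coefficients by 0.\<close>
    define U where "U = (\<lambda>w. case w of Node u v \<Rightarrow> u | _ \<Rightarrow> w) ` A"
    define V where "V = (\<lambda>w. case w of Node u v \<Rightarrow> v | _ \<Rightarrow> w) ` A"
    define k where "k u v = (if Node u v \<in> A then c (Node u v) else 0)" for u v
    have finU: "finite U" and finV: "finite V" using fin by (auto simp: U_def V_def)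
    have UV: "u \<in> U \<and> v \<in> V" if "Node u v \<in> A" for u v
      using that by (force simp: U_def V_def)
    have k: "weight \<omega> u + weight \<omega> v = d" if "k u v \<noteq> 0" for u v
      using that wA[of "Node u v"] by (auto simp: k_def split: if_splits)
    have double: "(\<Sum>u\<in>U. \<Sum>v\<in>V. k u v * word_coeff u s * word_coeff v t) = 0"
      if st: "word_length s + word_length t = d" for s t
    proof -
      let ?c = "\<lambda>w. if w \<in> A then c w else 0"
      let ?N = "(\<lambda>(u, v). Node u v) ` (U \<times> V)"
      have "(\<Sum>u\<in>U. \<Sum>v\<in>V. k u v * word_coeff u s * word_coeff v t)
          = (\<Sum>u\<in>U. \<Sum>v\<in>V. k u v * word_coeff (Node u v) (Node s t))"
        using k word_coeff_node[of s t] st by (intro sum.cong refl) (metis mult.assoc mult_zero_left)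
      also have "\<dots> = (\<Sum>(u, v)\<in>U \<times> V. k u v * word_coeff (Node u v) (Node s t))"
        by (rule sum.cartesian_product)
      also have "\<dots> = (\<Sum>w\<in>?N. ?c w * word_coeff w (Node s t))"
        by (subst sum.reindex) (auto simp: inj_on_def k_def intro!: sum.cong)
      also have "\<dots> = (\<Sum>w\<in>?N \<union> A. ?c w * word_coeff w (Node s t))"
      proof (rule sum.mono_neutral_left)
        show "\<forall>w\<in>?N \<union> A - ?N. ?c w * word_coeff w (Node s t) = 0"
        proof
          fix w assume w: "w \<in> ?N \<union> A - ?N"
          show "?c w * word_coeff w (Node s t) = 0"
          proof (cases w)
            case (Letter x)
            then show ?thesis using w letters[OF less.prems(1), of x] by auto
          next
            case (Node u v)
            then show ?thesis using w UV[of u v] by force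
          qed
        qed
      qed (use fin finU finV in auto)
      also have "\<dots> = (\<Sum>w\<in>A. c w * word_coeff w (Node s t))"
        using fin finU finV by (intro sum.mono_neutral_cong_right) auto
      also have "\<dots> = 0" using rel[of "Node s t"] st by simp
      finally show ?thesis .
    qed
    define e where "e = weight \<omega> u\<^sub>0"
    have d: "d = e + weight \<omega> v\<^sub>0" using wA[OF less.prems(2)] Node by (simp add: e_def)
    have ed: "e < d" "d - e < d" and e: "d - e = weight \<omega> v\<^sub>0"
      using d weight_ge_1[of u\<^sub>0] weight_ge_1[of v\<^sub>0] by (auto simp: e_def)
    define U' where "U' = {u\<in>U. weight \<omega> u = e}"
    define V' where "V' = {v\<in>V. weight \<omega> v = d - e}"
    have left: "(\<Sum>v\<in>V. k u v * word_coeff v t) = 0" if "u \<in> U'" and t: "word_length t = d - e" for u t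
    proof (rule less.IH[OF ed(1) _ that(1)])
      show "leading_relation e U' (\<lambda>u. \<Sum>v\<in>V. k u v * word_coeff v t)"
        unfolding leading_relation_def
      proof (intro conjI allI impI)
        fix s :: "'v nword" assume s: "word_length s = e"
        \<comment> \<open>A left factor of weight other than e is too light for s, or its partner is too light for t.\<close>
        have "k u v * word_coeff u s * word_coeff v t = 0" if "u \<in> U - U'" for u v
        proof (rule ccontr)
          assume nz: "k u v * word_coeff u s * word_coeff v t \<noteq> 0"
          then have "weight \<omega> u + weight \<omega> v = d" using k by force
          moreover have "weight \<omega> u \<noteq> e" using that by (simp add: U'_def)
          ultimately have "weight \<omega> u < word_length s \<or> weight \<omega> v < word_length t"
            using s t ed by linarith
          then show False using nz word_coeff_zero by auto
        qed
        then have "(\<Sum>u\<in>U'. \<Sum>v\<in>V. k u v * word_coeff u s * word_coeff v t) = (\<Sum>u\<in>U. \<Sum>v\<in>V. k u v * word_coeff u s * word_coeff v t)"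
          using finU by (intro sum.mono_neutral_left) (auto intro!: sum.neutral simp: U'_def simp del: mult_eq_0_iff)
        also have "\<dots> = 0" using double s t ed by simp
        finally show "(\<Sum>u\<in>U'. (\<Sum>v\<in>V. k u v * word_coeff v t) * word_coeff u s) = 0"
          by (simp add: sum_distrib_left sum_distrib_right mult_ac)
      qed (use finU in \<open>auto simp: U'_def\<close>)
    qed
    have "u\<^sub>0 \<in> U'" "v\<^sub>0 \<in> V'" using UV less.prems(2) Node e by (auto simp: U'_def V'_def e_def)
    have "leading_relation (d - e) V' (k u\<^sub>0)"
      unfolding leading_relation_def
    proof (intro conjI allI impI)
      fix t :: "'v nword" assume t: "word_length t = d - e"
      have "(\<Sum>v\<in>V'. k u\<^sub>0 v * word_coeff v t) = (\<Sum>v\<in>V. k u\<^sub>0 v * word_coeff v t)"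
        using finV k[of u\<^sub>0] by (intro sum.mono_neutral_left) (force simp: V'_def e_def)+
      then show "(\<Sum>v\<in>V'. k u\<^sub>0 v * word_coeff v t) = 0" using left[OF \<open>u\<^sub>0 \<in> U'\<close> t] by simp
    qed (use finV in \<open>auto simp: V'_def\<close>)
    then have "k u\<^sub>0 v\<^sub>0 = 0" using less.IH[OF ed(2)] \<open>v\<^sub>0 \<in> V'\<close> by blast
    then show ?thesis using less.prems(2) Node by (simp add: k_def)
  qed
qed

end

section \<open>Affine elements\<close>

definition affine :: "('v, 'k::field) free_alg \<Rightarrow> bool" where
  "affine p \<longleftrightarrow> (\<forall>w. coeff p (Some w) \<noteq> 0 \<longrightarrow> (\<exists>x. w = Letter x))"

lemma affine_var: "affine (fa_var x)"
  by (auto simp: affine_def fa_var_def lookup_single when_def)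

lemma affine_add: "affine p \<Longrightarrow> affine q \<Longrightarrow> affine (p + q)"
  unfolding affine_def lookup_add by (metis add.left_neutral)

lemma affine_scale: "affine p \<Longrightarrow> affine (fa_scale c p)"
  by (auto simp: affine_def lookup_fa_scale)

lemma affine_sum: "(\<And>a. a \<in> A \<Longrightarrow> affine (f a)) \<Longrightarrow> affine (sum f A)"
  by (induction A rule: infinite_finite_induct) (auto simp: affine_add, simp_all add: affine_def)

lemma affine_split:
  assumes "affine p"
  obtains r where "p = fa_scale (coeff p (Some (Letter x))) (fa_var x) + r" "x \<notin> fa_vars r" "affine r"
proof
  let ?r = "p + fa_scale (- coeff p (Some (Letter x))) (fa_var x)"
  show "p = fa_scale (coeff p (Some (Letter x))) (fa_var x) + ?r"
    by (rule poly_mapping_eqI) (simp add: lookup_add lookup_fa_scale)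
  show r: "affine ?r" by (intro affine_add affine_scale affine_var assms)
  have "coeff ?r (Some (Letter x)) = 0"
    by (simp add: lookup_add lookup_fa_scale fa_var_def)
  moreover have "w = Letter x" if "coeff ?r (Some w) \<noteq> 0" "x \<in> word_vars w" for w
    using r that unfolding affine_def by fastforce
  ultimately show "x \<notin> fa_vars ?r"
    unfolding fa_vars_def in_keys_iff by blast
qed

lemma affine_eval:
  assumes "\<And>x. affine (g x)" "affine p"
  shows "affine (fa_eval g p)"
  unfolding fa_eval_def
proof (intro affine_sum affine_scale)
  fix s assume s: "s \<in> Poly_Mapping.keys p"
  show "affine (eval_mon g s)"
  proof (cases s)
    case None
    then show ?thesis by (auto simp: affine_def fa_const_def lookup_single)
  next
    case (Some w)
    with s assms(2) obtain x where "w = Letter x" by (auto simp: affine_def in_keys_iff)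
    then show ?thesis using Some assms(1) by simp
  qed
qed

text \<open>
  Affine elementary substitutions have affine inverses, so composing with them keeps the property that
  elements with affine image are affine.
\<close>

lemma affine_elementary_preimage:
  assumes "\<alpha> \<noteq> 0" "x \<notin> fa_vars f" "affine f" "affine (elementary x \<alpha> f p)"
  shows "affine p"
proof -
  have "affine (elementary x (1 / \<alpha>) (fa_scale (- 1 / \<alpha>) f) (elementary x \<alpha> f p))"
    unfolding elementary_def[of x "1 / \<alpha>"]
    by (rule affine_eval) (auto intro: affine_add affine_scale affine_var assms)
  then show ?thesis by (simp only: elementary_inverse_comp[OF assms(1,2)])
qed

context weighted_hom begin

text \<open>
  If a word other than a letter occurs in \<open>p\<close>, then the highest weight \<open>d\<close> in \<open>p\<close> is at
  least 2. With all leading relations trivial, the part of weight \<open>d\<close> leaves words of length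
  \<open>d\<close> in the image, which is then not affine.
\<close>

lemma affine_preimage:
  assumes indep: "\<And>d A c w. leading_relation d A c \<Longrightarrow> w \<in> A \<Longrightarrow> c w = 0"
    and "affine (\<phi> p)"
  shows "affine p"
proof (rule ccontr)
  assume "\<not> affine p"
  then obtain w\<^sub>0 where w\<^sub>0: "coeff p (Some w\<^sub>0) \<noteq> 0" "\<And>x. w\<^sub>0 \<noteq> Letter x"
    by (auto simp: affine_def)
  define B where "B = {w. coeff p (Some w) \<noteq> 0}"
  have "Some ` B \<subseteq> Poly_Mapping.keys p" by (auto simp: B_def in_keys_iff)
  then have "finite (Some ` B)" by (rule finite_subset) simp
  then have finB: "finite B" by (rule finite_imageD) simp
  define d where "d = Max (weight \<omega> ` B)"
  have le: "weight \<omega> w \<le> d" if "w \<in> B" for w using that finB by (simp add: d_def)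
  have "weight \<omega> w\<^sub>0 \<ge> 2"
  proof (cases w\<^sub>0)
    case (Node u v)
    then show ?thesis using weight_ge_1[of u] weight_ge_1[of v] by simp
  qed (use w\<^sub>0 in simp)
  then have d2: "d \<ge> 2" using le[of w\<^sub>0] w\<^sub>0 by (simp add: B_def)
  define A where "A = {w\<in>B. weight \<omega> w = d}"
  have "leading_relation d A (\<lambda>w. coeff p (Some w))"
    unfolding leading_relation_def
  proof (intro conjI allI impI)
    fix t :: "'v nword" assume t: "word_length t = d"
    have "(\<Sum>w\<in>A. coeff p (Some w) * word_coeff w t) = (\<Sum>w\<in>B. coeff p (Some w) * word_coeff w t)"
    proof (rule sum.mono_neutral_left)
      show "\<forall>w\<in>B - A. coeff p (Some w) * word_coeff w t = 0"
        using le t by (auto simp: A_def intro!: word_coeff_zero le_neq_implies_less)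
    qed (use finB in \<open>auto simp: A_def\<close>)
    also have "\<dots> = coeff (\<phi> p) (Some t)"
      using finB by (subst coeff_hom[of B]) (auto simp: B_def)
    also have "\<dots> = 0"
      using assms(2) t d2 by (auto simp: affine_def)
    finally show "(\<Sum>w\<in>A. coeff p (Some w) * word_coeff w t) = 0" .
  qed (use finB in \<open>auto simp: A_def\<close>)
  moreover have "d \<in> weight \<omega> ` B"
    using finB w\<^sub>0 unfolding d_def by (intro Max_in) (auto simp: B_def)
  then obtain w where "w \<in> B" "d = weight \<omega> w" by (rule imageE)
  then have "w \<in> A" by (simp add: A_def)
  ultimately have "coeff p (Some w) = 0" by (rule indep)
  then show False using \<open>w \<in> B\<close> by (simp add: B_def)
qed

end

section \<open>Reduction of affine automorphisms\<close>

text \<open>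
  Gaussian elimination, one more fixed variable in each round. Let \<open>x\<close> be a variable of
  \<open>X\<close> not yet fixed and \<open>p\<close> its preimage, which is affine. If \<open>x\<close> occurs in
  \<open>p\<close>, then \<open>x \<mapsto> p\<close> is an elementary substitution whose composition with \<open>\<phi>\<close>
  fixes \<open>x\<close>. Otherwise some other unfixed \<open>y\<close> occurs in \<open>p\<close>, for else \<open>\<phi>\<close> would
  fix \<open>p\<close>; the substitution \<open>y \<mapsto> y - x\<close> then brings \<open>x\<close> into the preimage.
\<close>

lemma Z_tame_affine:
  fixes X Z :: "'v set" and \<phi> :: "('v, 'k::field) free_alg \<Rightarrow> ('v, 'k) free_alg"
  assumes "finite X" "X \<inter> Z = {}" "X \<union> Z = UNIV"
    and "S \<subseteq> X" "Z_automorphism Z \<phi>" "\<And>y. y \<in> S \<Longrightarrow> \<phi> (fa_var y) = fa_var y"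
    and "\<And>p. affine (\<phi> p) \<Longrightarrow> affine p"
  shows "Z_tame X Z \<phi>"
  using assms(4-)
proof (induction "card (X - S)" arbitrary: S \<phi>)
  case 0
  then have "X = S" using assms(1) by auto
  then have "\<phi> (fa_var y) = fa_var y" for y
    using 0 assms(3) by (cases "y \<in> X") (auto simp: Z_automorphism_def)
  then have "\<phi> = id"
    using 0 fa_hom_fixes[of \<phi>] by (auto simp: Z_automorphism_def fa_automorphism_def)
  then show ?case by (simp only: Z_tame_id)
next
  case (Suc n)
  then obtain x where x: "x \<in> X" "x \<notin> S" by (metis Diff_eq_empty_iff card.empty subsetI nat.distinct(1))
  have n: "n = card (X - insert x S)"
    using Suc.hyps(2) assms(1) x by (simp add: card_Diff_insert)
  have pivot: "Z_tame X Z \<psi>"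
    if \<psi>: "Z_automorphism Z \<psi>" "\<And>y. y \<in> S \<Longrightarrow> \<psi> (fa_var y) = fa_var y"
      "\<And>p. affine (\<psi> p) \<Longrightarrow> affine p"
      and p: "\<psi> p = fa_var x" "coeff p (Some (Letter x)) \<noteq> 0"
    for \<psi> :: "('v, 'k) free_alg \<Rightarrow> ('v, 'k) free_alg" and p
  proof -
    have "affine p" using \<psi>(3) p(1) affine_var by metis
    then obtain f where f: "p = fa_scale (coeff p (Some (Letter x))) (fa_var x) + f"
        "x \<notin> fa_vars f" "affine f"
      by (rule affine_split[where x = x])
    let ?\<epsilon> = "elementary x (coeff p (Some (Letter x))) f"
    have im: "(\<psi> \<circ> ?\<epsilon>) (fa_var y) = fa_var y" if "y \<in> insert x S" for y
      using that f(1) p(1) x(2) \<psi>(2) by (cases "y = x") (auto simp: elementary_same elementary_other)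
    show ?thesis
    proof (rule Z_tame_cancel_elementary[OF p(2) f(2) x(1) _ \<psi>(1)])
      assume aut: "Z_automorphism Z (\<psi> \<circ> ?\<epsilon>)"
      show "Z_tame X Z (\<psi> \<circ> ?\<epsilon>)"
      proof (rule Suc.hyps(1)[OF n])
        show "insert x S \<subseteq> X" using x Suc.prems(1) by simp
        show "Z_automorphism Z (\<psi> \<circ> ?\<epsilon>)" by (rule aut)
        show "(\<psi> \<circ> ?\<epsilon>) (fa_var y) = fa_var y" if "y \<in> insert x S" for y
          using that by (rule im)
        show "affine q" if "affine ((\<psi> \<circ> ?\<epsilon>) q)" for q
          using affine_elementary_preimage[OF p(2) f(2,3)] \<psi>(3) that unfolding comp_apply .
      qed
    qed (use x assms(2) in auto)
  qed
  have hom: "fa_hom \<phi>" and "bij \<phi>"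
    using Suc.prems by (auto simp: Z_automorphism_def fa_automorphism_def)
  then obtain p where p: "\<phi> p = fa_var x" by (metis bij_pointE)
  then have aff: "affine p" using Suc.prems(4) affine_var by metis
  show ?case
  proof (cases "coeff p (Some (Letter x)) = 0")
    case False
    show ?thesis
    proof (rule pivot[where \<psi> = \<phi> and p = p])
      show "\<phi> (fa_var y) = fa_var y" if "y \<in> S" for y using that by (rule Suc.prems(3))
      show "affine q" if "affine (\<phi> q)" for q using that by (rule Suc.prems(4))
    qed (fact Suc.prems(2) p False)+
  next
    case True
    have "\<exists>y. y \<notin> Z \<union> S \<and> coeff p (Some (Letter y)) \<noteq> 0"
    proof (rule ccontr)
      assume none: "\<not> ?thesis"
      have "fa_vars p \<subseteq> Z \<union> S"
      proof
        fix y assume "y \<in> fa_vars p"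
        then obtain w where w: "coeff p (Some w) \<noteq> 0" "y \<in> word_vars w"
          by (auto simp: fa_vars_def in_keys_iff)
        moreover from w(1) obtain y' where "w = Letter y'" using aff by (auto simp: affine_def)
        ultimately have "coeff p (Some (Letter y)) \<noteq> 0" by simp
        then show "y \<in> Z \<union> S" using none by blast
      qed
      then have "\<phi> p = p"
        using Suc.prems(2,3) by - (rule fa_hom_fixes[OF hom], auto simp: Z_automorphism_def)
      then have "p = fa_var x" using p by simp
      then show False using True by (simp add: fa_var_def)
    qed
    then obtain y where y: "y \<notin> Z" "y \<notin> S" "coeff p (Some (Letter y)) \<noteq> 0" by auto
    have yx: "y \<noteq> x" using y True by auto
    \<comment> \<open>The inverse of the substitution below sends y to y + x, so it turns p into p + c x, where c
      is the coefficient of y in p.\<close>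
    let ?f = "fa_scale (- 1) (fa_var x) :: ('v, 'k) free_alg"
    let ?\<epsilon> = "elementary y 1 ?f"
    let ?c = "coeff p (Some (Letter y))"
    have vf: "y \<notin> fa_vars ?f"
      using yx fa_vars_scale[of "-1" "fa_var x"] by (auto simp: fa_vars_def fa_var_def)
    obtain r where r: "p = fa_scale ?c (fa_var y) + r" "y \<notin> fa_vars r"
      using aff by (rule affine_split[where x = y])
    have "?\<epsilon> p = fa_scale ?c (fa_var y + ?f) + r"
      using r(2) by (subst r(1)) (simp add: fa_hom_add[OF fa_hom_elementary]
          fa_hom_scale[OF fa_hom_elementary] elementary_same elementary_fixes)
    then have "?\<epsilon> (p + fa_scale ?c (fa_var x)) = fa_scale ?c (fa_var y + ?f) + r + fa_scale ?c (fa_var x)"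
      using yx by (simp add: fa_hom_add[OF fa_hom_elementary]
          fa_hom_scale[OF fa_hom_elementary] elementary_other)
    also have "\<dots> = fa_scale ?c (fa_var y) + r"
      by (rule poly_mapping_eqI) (simp add: lookup_add lookup_fa_scale algebra_simps)
    finally have q: "(\<phi> \<circ> ?\<epsilon>) (p + fa_scale ?c (fa_var x)) = fa_var x"
      using r(1) p by simp
    show ?thesis
    proof (rule Z_tame_cancel_elementary[OF _ vf _ y(1) Suc.prems(2)])
      assume aut: "Z_automorphism Z (\<phi> \<circ> ?\<epsilon>)"
      show "Z_tame X Z (\<phi> \<circ> ?\<epsilon>)"
      proof (rule pivot[where \<psi> = "\<phi> \<circ> ?\<epsilon>" and p = "p + fa_scale ?c (fa_var x)"])
        show "(\<phi> \<circ> ?\<epsilon>) (fa_var z) = fa_var z" if "z \<in> S" for z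
          using that y(2) Suc.prems(3)[OF that] by (cases "z = y") (auto simp: elementary_other)
        show "affine a" if "affine ((\<phi> \<circ> ?\<epsilon>) a)" for a
        proof (rule affine_elementary_preimage[OF _ vf])
          show "affine (?\<epsilon> a)" using Suc.prems(4) that by simp
        qed (simp_all add: affine_scale affine_var)
        show "coeff (p + fa_scale ?c (fa_var x)) (Some (Letter x)) \<noteq> 0"
          using y(3) True by (simp add: lookup_add lookup_fa_scale fa_var_def)
      qed (fact aut q)+
    qed (use y assms(3) in auto)
  qed
qed

section \<open>Reduction of the degree\<close>

text \<open>
  Constants are fixed, so by injectivity no variable is sent to one. Hence the degrees of the images
  can serve as positive weights.
\<close>

lemma fa_degree_image_var:
  assumes "fa_automorphism \<phi>"
  shows "fa_degree (\<phi> (fa_var x)) \<ge> 1"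
proof (rule ccontr)
  assume "\<not> ?thesis"
  then obtain c where c: "\<phi> (fa_var x) = fa_const c"
    using fa_degree_zero[of "\<phi> (fa_var x)"] by fastforce
  have "fa_const c = fa_scale c (fa_const 1)"
    by (simp add: fa_const_def fa_scale_single)
  then have "\<phi> (fa_const c) = fa_const c"
    using assms unfolding fa_automorphism_def fa_hom_def by metis
  then have "\<phi> (fa_var x) = \<phi> (fa_const c)" using c by simp
  moreover have "inj \<phi>" using assms by (simp add: fa_automorphism_def bij_def)
  ultimately have "fa_var x = fa_const c" by (simp add: inj_eq)
  then have "coeff (fa_var x :: ('a, 'b) free_alg) (Some (Letter x)) = coeff (fa_const c) (Some (Letter x))"
    by simp
  then show False by (simp add: fa_var_def fa_const_def lookup_single)
qed

context weighted_hom begin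

text \<open>
  The remaining words of the relation have the same weight as \<open>x\<close> and differ from it, so they
  do not contain \<open>x\<close>; they make up \<open>f\<close>.
\<close>

lemma leading_relation_reduces_degree:
  assumes rel: "leading_relation d A c" and x: "Letter x \<in> A"
  obtains f where "x \<notin> fa_vars f" "fa_degree (\<phi> (fa_scale (c (Letter x)) (fa_var x) + f)) < \<omega> x"
proof
  have d: "d = \<omega> x" and fin: "finite A" using rel x by (auto simp: leading_relation_def)
  define f where "f = (\<Sum>w\<in>A - {Letter x}. fa_scale (c w) (monomial (Some w)))"
  define p where "p = (\<Sum>w\<in>A. fa_scale (c w) (monomial (Some w)))"
  have p: "p = fa_scale (c (Letter x)) (fa_var x) + f"
    using fin x by (simp add: p_def f_def fa_var_def sum.remove)
  show "x \<notin> fa_vars f"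
  proof
    assume "x \<in> fa_vars f"
    then obtain w where w: "coeff f (Some w) \<noteq> 0" "x \<in> word_vars w"
      by (auto simp: fa_vars_def in_keys_iff)
    from w(1) have "w \<in> A - {Letter x}"
      using fin by (auto simp: f_def lookup_sum fa_scale_single lookup_single when_def split: if_splits)
    then show False
      using weight_occurs[of \<omega>, OF pos w(2)] rel d by (auto simp: leading_relation_def)
  qed
  have "coeff (\<phi> p) (Some t) = 0" if "word_length t = d" for t
    using rel that by (simp add: p_def coeff_hom_combination leading_relation_def)
  then have ne: "mon_length s \<noteq> d" if "coeff (\<phi> p) s \<noteq> 0" for s
    using that pos[of x] d by (cases s) auto
  have "fa_degree (\<phi> p) \<le> d"
    using rel unfolding p_def by (intro degree_hom_combination) (simp add: leading_relation_def)
  then have "mon_length s \<le> d - 1" if "coeff (\<phi> p) s \<noteq> 0" for s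
    using ne[OF that] mon_length_le_degree[OF that] by linarith
  then have "fa_degree (\<phi> p) \<le> d - 1"
    unfolding fa_degree_le_iff by blast
  then show "fa_degree (\<phi> (fa_scale (c (Letter x)) (fa_var x) + f)) < \<omega> x"
    using pos[of x] unfolding d p[symmetric] by linarith
qed

text \<open>
  A letter of weight 1 forces all words of the relation to have weight 1, hence to be letters.
  Those with nonzero coefficient are fixed, and distinct fixed letters are linearly independent.
\<close>

lemma leading_relation_fixed_letter:
  assumes rel: "leading_relation d A c" and z: "Letter z \<in> A" "\<omega> z = 1"
    and linear: "\<And>y. Letter y \<in> A \<Longrightarrow> c (Letter y) \<noteq> 0 \<Longrightarrow> \<phi> (fa_var y) = fa_var y"
  shows "c (Letter z) = 0"
proof (rule ccontr)
  assume nz: "c (Letter z) \<noteq> 0"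
  have d: "d = 1" and fin: "finite A"
    using rel z by (auto simp: leading_relation_def)
  have letter: "\<exists>y. w = Letter y" if "w \<in> A" for w
  proof (cases w)
    case (Node u v)
    have "weight \<omega> w = 1" using rel that d by (simp add: leading_relation_def)
    then show ?thesis using weight_ge_1[of u] weight_ge_1[of v] Node by simp
  qed simp
  have "c w * word_coeff w (Letter z) = 0" if w: "w \<in> A - {Letter z}" for w
  proof -
    obtain y where "w = Letter y" using letter w by blast
    then show ?thesis
      using linear[of y] w by (cases "c w = 0") (auto simp: word_coeff_def fa_var_def lookup_single)
  qed
  then have "(\<Sum>w\<in>A - {Letter z}. c w * word_coeff w (Letter z)) = 0"
    by (rule sum.neutral[OF ballI])
  moreover have "word_coeff (Letter z) (Letter z) = 1"
    using linear[OF z(1) nz] by (simp add: word_coeff_def fa_var_def)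
  ultimately have "(\<Sum>w\<in>A. c w * word_coeff w (Letter z)) = c (Letter z)"
    using fin z(1) by (simp add: sum.remove[of A "Letter z"])
  moreover have "(\<Sum>w\<in>A. c w * word_coeff w (Letter z)) = 0"
    using rel d by (simp add: leading_relation_def)
  ultimately show False using nz by simp
qed

end

theorem theorem4p3:
  fixes X Z :: "'v set"
    and \<phi> :: "('v, 'k::field) free_alg \<Rightarrow> ('v, 'k) free_alg"
  assumes "finite X" and "finite Z"
    and "X \<inter> Z = {}" and "X \<union> Z = UNIV"
    and "card X \<ge> 2"
    and "Z_automorphism Z \<phi>"
  shows "Z_tame X Z \<phi>"
  using assms(6)
proof (induction "\<Sum>x\<in>X. fa_degree (\<phi> (fa_var x))" arbitrary: \<phi> rule: less_induct)
  case less
  define \<omega> where "\<omega> x = fa_degree (\<phi> (fa_var x))" for x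
  have aut: "fa_automorphism \<phi>" and hom: "fa_hom \<phi>"
    and fixes_Z: "\<And>z. z \<in> Z \<Longrightarrow> \<phi> (fa_var z) = fa_var z"
    using less.prems by (auto simp: Z_automorphism_def fa_automorphism_def)
  interpret weighted_hom \<phi> \<omega>
    by unfold_locales (use hom aut fa_degree_image_var in \<open>auto simp: \<omega>_def\<close>)
  show ?case
  proof (cases "\<exists>d A c x. leading_relation d A c \<and> x \<in> X \<and> Letter x \<in> A \<and> c (Letter x) \<noteq> 0")
    case True
    then obtain d A c x where rel: "leading_relation d A c" and x: "x \<in> X" "Letter x \<in> A" "c (Letter x) \<noteq> 0"
      by blast
    obtain f where f: "x \<notin> fa_vars f" "fa_degree (\<phi> (fa_scale (c (Letter x)) (fa_var x) + f)) < \<omega> x"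
      using rel x(2) by (rule leading_relation_reduces_degree)
    let ?\<psi> = "\<phi> \<circ> elementary x (c (Letter x)) f"
    have lt: "fa_degree (?\<psi> (fa_var x)) < fa_degree (\<phi> (fa_var x))"
      using f(2) by (simp add: elementary_same \<omega>_def)
    have "(\<Sum>y\<in>X. fa_degree (?\<psi> (fa_var y))) < (\<Sum>y\<in>X. fa_degree (\<phi> (fa_var y)))"
    proof (rule sum_strict_mono_ex1[OF assms(1)])
      show "\<forall>y\<in>X. fa_degree (?\<psi> (fa_var y)) \<le> fa_degree (\<phi> (fa_var y))"
      proof
        fix y
        show "fa_degree (?\<psi> (fa_var y)) \<le> fa_degree (\<phi> (fa_var y))"
          using lt by (cases "y = x") (auto simp: elementary_other)
      qed
      show "\<exists>y\<in>X. fa_degree (?\<psi> (fa_var y)) < fa_degree (\<phi> (fa_var y))"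
        using lt x(1) by blast
    qed
    then have "Z_tame X Z ?\<psi>" if "Z_automorphism Z ?\<psi>"
      using that by (rule less.hyps)
    moreover have "x \<notin> Z" using x(1) assms(3) by blast
    ultimately show ?thesis
      using Z_tame_cancel_elementary[OF x(3) f(1) x(1) _ less.prems] by blast
  next
    case False
    \<comment> \<open>Letters of X are excluded by the case assumption; letters of Z are fixed.\<close>
    have letters: "c (Letter x) = 0" if rel: "leading_relation d A c" and x: "Letter x \<in> A" for d A c x
    proof (cases "x \<in> X")
      case True
      then show ?thesis using False that by blast
    next
      case x': False
      have fixed: "\<phi> (fa_var y) = fa_var y" if "Letter y \<in> A" "c (Letter y) \<noteq> 0 \<or> y = x" for y
        using that rel False x' assms(4) fixes_Z by blast
      have "\<omega> x = 1"
        using fixed[OF x] by (simp add: \<omega>_def fa_degree_def fa_var_def)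
      then show ?thesis
        using fixed by (intro leading_relation_fixed_letter[OF rel x]) auto
    qed
    have trivial: "c w = 0" if "leading_relation d A c" "w \<in> A" for d A c w
    proof (rule leading_relation_trivial[OF _ that])
      show "k (Letter x) = 0" if "leading_relation e B k" "Letter x \<in> B" for e B k x
        using that by (rule letters)
    qed
    have affine: "affine p" if "affine (\<phi> p)" for p
    proof (rule affine_preimage[OF _ that])
      show "c w = 0" if "leading_relation d A c" "w \<in> A" for d A c w
        using that by (rule trivial)
    qed
    show ?thesis
    proof (rule Z_tame_affine[OF assms(1,3,4) empty_subsetI less.prems])
      show "affine p" if "affine (\<phi> p)" for p using that by (rule affine)
    qed simp
  qed
qed

end
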